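(* Let $G$ be a graph. A set $X\subseteq V(G)$ is a positive influence dominating set if and only if $X$ is a global $(\{d\in\mathbb{Z} : d\geq 0\},\{o\in\mathbb{Z} : o\geq 0\})$-alliance.
   Context: Graphs are finite and simple. For a graph $G=(V,E)$, $S\subseteq V$ and $v\in V$, $N_S(v)$ is the set of neighbors of $v$ lying in $S$, $\delta_S(v)=|N_S(v)|$, $\delta(v)=\delta_V(v)$ is the degree, $\overline{S}=V\setminus S$, $N(S)=\bigcup_{u\in S}N_V(u)$ and $N[S]=N(S)\cup S$. A set $S$ is dominating if $N[S]=V$. For $D,O\subseteq\mathbb{Z}$, a $(D,O)$-alliance in $G$ is a vertex set $S$ such that (1) $\delta_S(v)-\delta_{\overline{S}}(v)\in D$ for all $v\in S$, and (2) $\delta_S(v)-\delta_{\overline{S}}(v)\in O$ for all $v\in N(S)\setminus S$. It is called global if $S$ is also a dominating set. A positive influence dominating set in $G$ is a vertex set $X\subseteq V$ such that every $v\in V$ is a neighbor of at least $\left\lceil \frac{\delta(v)}{2}\right\rceil$ vertices of $X$.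
   Formalization: The formal theorem additionally assumes that X contains every isolated vertex of G; without this the claim fails, e.g. for the one-vertex graph with X empty, which is a positive influence dominating set but not dominating. *)

theory Defs
  imports Complex_Main "Graph_Theory.Digraph"
begin

text \<open>
  Finite simple graphs are finite, loop-free, symmetric digraphs without parallel arcs,
  i.e. the locale \<^locale>\<open>graph\<close>; an edge is a pair of opposite arcs.
\<close>

definition nbrs :: "('a, 'b) pre_digraph \<Rightarrow> 'a set \<Rightarrow> 'a \<Rightarrow> 'a set" where
  "nbrs G S v = {u \<in> S. v \<rightarrow>\<^bsub>G\<^esub> u}"

definition deg_in :: "('a, 'b) pre_digraph \<Rightarrow> 'a set \<Rightarrow> 'a \<Rightarrow> nat" where
  "deg_in G S v = card (nbrs G S v)"

definition vert_degree :: "('a, 'b) pre_digraph \<Rightarrow> 'a \<Rightarrow> nat" where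
  "vert_degree G v = deg_in G (verts G) v"

definition open_nbhd :: "('a, 'b) pre_digraph \<Rightarrow> 'a set \<Rightarrow> 'a set" where
  "open_nbhd G S = (\<Union>u\<in>S. nbrs G (verts G) u)"

definition closed_nbhd :: "('a, 'b) pre_digraph \<Rightarrow> 'a set \<Rightarrow> 'a set" where
  "closed_nbhd G S = open_nbhd G S \<union> S"

definition dominating :: "('a, 'b) pre_digraph \<Rightarrow> 'a set \<Rightarrow> bool" where
  "dominating G S \<longleftrightarrow> S \<subseteq> verts G \<and> closed_nbhd G S = verts G"

definition alliance :: "int set \<Rightarrow> int set \<Rightarrow> ('a, 'b) pre_digraph \<Rightarrow> 'a set \<Rightarrow> bool" where
  "alliance D P G S \<longleftrightarrow> S \<subseteq> verts G \<and>
     (\<forall>v\<in>S. int (deg_in G S v) - int (deg_in G (verts G - S) v) \<in> D) \<and>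
     (\<forall>v\<in>open_nbhd G S - S. int (deg_in G S v) - int (deg_in G (verts G - S) v) \<in> P)"

definition global_alliance :: "int set \<Rightarrow> int set \<Rightarrow> ('a, 'b) pre_digraph \<Rightarrow> 'a set \<Rightarrow> bool" where
  "global_alliance D P G S \<longleftrightarrow> alliance D P G S \<and> dominating G S"

text \<open>
  The condition is void at isolated vertices: on its own it forces \<open>X\<close> to dominate
  every vertex except isolated vertices outside \<open>X\<close>.
\<close>

definition positive_influence_dominating :: "('a, 'b) pre_digraph \<Rightarrow> 'a set \<Rightarrow> bool" where
  "positive_influence_dominating G X \<longleftrightarrow> X \<subseteq> verts G \<and>
     (\<forall>v\<in>verts G. \<lceil>real (vert_degree G v) / 2\<rceil> \<le> int (card {u \<in> X. u \<rightarrow>\<^bsub>G\<^esub> v}))"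

end

theory Submission
  imports Defs
begin

text \<open>
  Since the degree of a vertex \<open>v\<close> splits as the number of its neighbours in \<open>X\<close> plus the
  number outside \<open>X\<close>, having at least half of the neighbours in \<open>X\<close> means exactly that
  the difference of these two numbers is nonnegative (\<open>half_degree_le_iff\<close>). So \<open>X\<close> is positive
  influence dominating iff the difference is nonnegative at every vertex, whereas the alliance
  conditions ask for this on \<open>N[X]\<close> only. The two agree when \<open>X\<close> is dominating. Conversely,
  if the difference is nonnegative everywhere then a vertex of positive degree has a neighbour
  in \<open>X\<close>, while vertices of degree zero lie in \<open>X\<close> by hypothesis; hence \<open>X\<close> is dominating.
\<close>

lemma (in graph) adj_sym: "u \<rightarrow>\<^bsub>G\<^esub> v \<longleftrightarrow> v \<rightarrow>\<^bsub>G\<^esub> u"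
  using sym_arcs by (auto simp: symmetric_def dest: symD)

lemma (in graph) vert_degree_split:
  assumes "X \<subseteq> verts G"
  shows "vert_degree G v = deg_in G X v + deg_in G (verts G - X) v"
proof -
  have "nbrs G (verts G) v = nbrs G X v \<union> nbrs G (verts G - X) v"
    using assms by (auto simp: nbrs_def)
  moreover have "finite (nbrs G X v)" "finite (nbrs G (verts G - X) v)"
    using assms by (auto simp: nbrs_def intro: finite_subset[OF _ finite_verts])
  moreover have "nbrs G X v \<inter> nbrs G (verts G - X) v = {}"
    by (auto simp: nbrs_def)
  ultimately show ?thesis
    by (simp add: vert_degree_def deg_in_def card_Un_disjoint)
qed

lemma (in graph) half_degree_le_iff:
  assumes "X \<subseteq> verts G"
  shows "\<lceil>real (vert_degree G v) / 2\<rceil> \<le> int (card {u \<in> X. u \<rightarrow>\<^bsub>G\<^esub> v}) \<longleftrightarrow>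
         0 \<le> int (deg_in G X v) - int (deg_in G (verts G - X) v)"
proof -
  have "card {u \<in> X. u \<rightarrow>\<^bsub>G\<^esub> v} = deg_in G X v"
    by (simp add: deg_in_def nbrs_def adj_sym[of v])
  then show ?thesis
    using vert_degree_split[OF assms, of v] by (simp add: ceiling_le_iff)
qed

lemma (in graph) in_open_nbhd_if_deg_in_pos:
  assumes "v \<in> verts G" and "deg_in G X v > 0"
  shows "v \<in> open_nbhd G X"
proof -
  from assms(2) obtain u where "u \<in> X" "v \<rightarrow>\<^bsub>G\<^esub> u"
    by (auto simp: deg_in_def nbrs_def card_gt_0_iff)
  with assms(1) show ?thesis
    by (auto simp: open_nbhd_def nbrs_def adj_sym[of v])
qed

theorem proposition12:
  fixes G :: "('a, 'b) pre_digraph" and X :: "'a set"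
  assumes "graph G"
    and "X \<subseteq> verts G"
    and isolated: "\<And>v. v \<in> verts G \<Longrightarrow> vert_degree G v = 0 \<Longrightarrow> v \<in> X"
  shows "positive_influence_dominating G X \<longleftrightarrow>
         global_alliance {d :: int. d \<ge> 0} {r :: int. r \<ge> 0} G X"
proof -
  interpret graph G by fact
  let ?nonneg = "\<lambda>v. 0 \<le> int (deg_in G X v) - int (deg_in G (verts G - X) v)"
  have pid: "positive_influence_dominating G X \<longleftrightarrow> (\<forall>v\<in>verts G. ?nonneg v)"
    using \<open>X \<subseteq> verts G\<close>
    by (simp add: positive_influence_dominating_def half_degree_le_iff)
  have nbhd_sub: "open_nbhd G X \<subseteq> verts G"
    by (auto simp: open_nbhd_def nbrs_def)
  show ?thesis
  proof
    assume "positive_influence_dominating G X"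
    then have nonneg: "?nonneg v" if "v \<in> verts G" for v
      using pid that by blast
    have "v \<in> closed_nbhd G X" if v: "v \<in> verts G" for v
    proof (cases "vert_degree G v = 0")
      case True
      then show ?thesis
        using isolated v by (simp add: closed_nbhd_def)
    next
      case False
      then have "deg_in G X v > 0"
        using nonneg[OF v] vert_degree_split[OF \<open>X \<subseteq> verts G\<close>, of v] by linarith
      then show ?thesis
        using in_open_nbhd_if_deg_in_pos v by (simp add: closed_nbhd_def)
    qed
    then have "dominating G X"
      using nbhd_sub \<open>X \<subseteq> verts G\<close> by (auto simp: dominating_def closed_nbhd_def)
    moreover have "alliance {d. d \<ge> 0} {r. r \<ge> 0} G X"
      unfolding alliance_def mem_Collect_eq
      using nonneg nbhd_sub \<open>X \<subseteq> verts G\<close> by blast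
    ultimately show "global_alliance {d. d \<ge> 0} {r. r \<ge> 0} G X"
      by (simp add: global_alliance_def)
  next
    assume "global_alliance {d. d \<ge> 0} {r. r \<ge> 0} G X"
    then have "\<forall>v\<in>closed_nbhd G X. ?nonneg v" and "closed_nbhd G X = verts G"
      unfolding global_alliance_def alliance_def dominating_def closed_nbhd_def mem_Collect_eq
      by blast+
    then show "positive_influence_dominating G X"
      using pid by simp
  qed
qed

end
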